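(* For $\alpha\in(0,1]$ and $\lambda^{(\alpha)}_n\in\mathbb{C}$ ($n=1,\dots,N_t$) given by $$\lambda^{(\alpha)}_n=\sum_{j=0}^{2} r_j\,\alpha^{j/N_t}\,\theta^{(n-1)j},\qquad r_0=\tfrac32,\quad r_1=-2,\quad r_2=\tfrac12,\qquad \theta=e^{2\pi \mathrm{i}/N_t},$$ it holds that $\mathrm{Re}(\lambda^{(\alpha)}_n)\geq 0$, where the equality is true if and only if $\alpha=1$.
   Context: Here $N_t$ is a positive integer (the number of time steps), $\mathrm{i}$ is the imaginary unit and $\alpha^{j/N_t}$ is the positive real power. The numbers $\lambda^{(\alpha)}_1,\dots,\lambda^{(\alpha)}_{N_t}$ are the eigenvalues of the $\alpha$-circulant matrix $C_\alpha\in\mathbb{R}^{N_t\times N_t}$ with diagonal entries $\frac32$, first subdiagonal entries $-2$, second subdiagonal entries $\frac12$, entries $(C_\alpha)_{1,N_t}=-2\alpha$, $(C_\alpha)_{1,N_t-1}=(C_\alpha)_{2,N_t}=\frac{\alpha}{2}$, and zeros elsewhere.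
   Formalization: The equality clause is formalized as: Re(λ_n) = 0 for some n in {1,…,N_t} if and only if α = 1. Read for each n separately it is false: for N_t = 2, α = 1, n = 2 one gets λ_2 = 4. *)

theory Defs
  imports Complex_Main
begin

definition bdf2_coeff :: "nat \<Rightarrow> real" where
  "bdf2_coeff j = (if j = 0 then 3/2 else if j = 1 then -2 else if j = 2 then 1/2 else 0)"

definition root_theta :: "nat \<Rightarrow> complex" where
  "root_theta Nt = exp (2 * of_real pi * \<i> / of_nat Nt)"

(* The index n is meant to range over {1..Nt}, so the truncated subtraction n - 1 is exact. *)
definition circ_eigenvalue :: "nat \<Rightarrow> real \<Rightarrow> nat \<Rightarrow> complex" where
  "circ_eigenvalue Nt \<alpha> n =
     (\<Sum>j=0..2. of_real (bdf2_coeff j) * of_real (\<alpha> powr (real j / real Nt))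
                * root_theta Nt ^ ((n - 1) * j))"

end

theory Submission
  imports Defs
begin

text \<open>
  With z = \<alpha>^(1/Nt) \<theta>^(n-1) the eigenvalue is 3/2 - 2z + z^2/2, whose real part is
  (1 - Re z)^2 + (1 - |z|^2)/2. Since |z| = \<alpha>^(1/Nt), this is nonnegative, and positive when
  \<alpha> < 1; for \<alpha> = 1 it vanishes at n = 1, where z = 1.
\<close>

lemma norm_root_theta: "norm (root_theta Nt) = 1"
  by (simp add: root_theta_def)

text \<open>With x = Re z, substitute Re(z^2) = 2 x^2 - |z|^2 and complete the square in x.\<close>

lemma Re_bdf2_symbol:
  "Re (3/2 - 2 * z + z\<^sup>2 / 2) = (1 - Re z)\<^sup>2 + (1 - (norm z)\<^sup>2) / 2"
  unfolding cmod_power2 by (simp add: power2_eq_square field_simps)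

lemma Re_circ_eigenvalue:
  assumes "0 < \<alpha>"
  shows "Re (circ_eigenvalue Nt \<alpha> n) =
    (1 - Re (of_real (\<alpha> powr (1 / real Nt)) * root_theta Nt ^ (n - 1)))\<^sup>2
      + (1 - (\<alpha> powr (1 / real Nt))\<^sup>2) / 2"
proof -
  define b where "b = \<alpha> powr (1 / real Nt)"
  define z where "z = of_real b * root_theta Nt ^ (n - 1)"
  \<comment> \<open>Positivity of \<alpha> matters at j = 0: \<open>0 powr 0\<close> is 0, but
    \<open>b ^ 0\<close> is 1.\<close>
  have "\<alpha> powr (real j / real Nt) = b ^ j" for j
    using assms by (simp add: b_def powr_power)
  then have "circ_eigenvalue Nt \<alpha> n = (\<Sum>j=0..2. of_real (bdf2_coeff j) * z ^ j)"
    unfolding circ_eigenvalue_def z_def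
    by (simp add: power_mult_distrib power_mult mult.assoc)
  also have "\<dots> = 3/2 - 2 * z + z\<^sup>2 / 2"
    by (simp add: bdf2_coeff_def numeral_2_eq_2)
  finally have "Re (circ_eigenvalue Nt \<alpha> n) = (1 - Re z)\<^sup>2 + (1 - (norm z)\<^sup>2) / 2"
    by (simp only: Re_bdf2_symbol)
  moreover have "norm z = b"
    by (simp add: z_def b_def norm_mult norm_power norm_root_theta)
  ultimately show ?thesis
    by (simp only: z_def b_def)
qed

text \<open>Equality is read as holding for some n: with \<alpha> = 1, Nt = 2, n = 2 one gets z = -1
  and real part 4.\<close>

theorem proposition3p1:
  fixes Nt :: nat and \<alpha> :: real
  assumes "Nt \<ge> 1" and "0 < \<alpha>" and "\<alpha> \<le> 1"
  shows "(\<forall>n\<in>{1..Nt}. Re (circ_eigenvalue Nt \<alpha> n) \<ge> 0) \<and>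
         ((\<exists>n\<in>{1..Nt}. Re (circ_eigenvalue Nt \<alpha> n) = 0) \<longleftrightarrow> \<alpha> = 1)"
proof (cases "\<alpha> = 1")
  case True
  have "Re (circ_eigenvalue Nt \<alpha> 1) = 0"
    using True by (simp add: Re_circ_eigenvalue)
  moreover have "Re (circ_eigenvalue Nt \<alpha> n) \<ge> 0" for n
    using True by (simp add: Re_circ_eigenvalue)
  \<comment> \<open>\<open>Nt \<ge> 1\<close> puts the witness n = 1 in range.\<close>
  ultimately show ?thesis
    using True assms(1) by (metis atLeastAtMost_iff order_refl)
next
  case False
  \<comment> \<open>Strictness needs a positive exponent, hence \<open>Nt \<ge> 1\<close>: for Nt =
    0, \<open>1 / real Nt\<close> is 0 and the power is 1.\<close>
  have "\<alpha> powr (1 / real Nt) < 1"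
    using assms False powr_less_mono2[of "1 / real Nt" \<alpha> 1] by simp
  then have "(\<alpha> powr (1 / real Nt))\<^sup>2 < 1"
    by (simp add: power_less_one_iff)
  then have "Re (circ_eigenvalue Nt \<alpha> n) > 0" for n
    unfolding Re_circ_eigenvalue[OF assms(2)] by (intro add_nonneg_pos) auto
  then show ?thesis
    using False by (metis less_eq_real_def less_irrefl)
qed

end
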